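(* If $n \geq 3$, then $C_5 \,\Box\, C_n$ is nearly dispersable.
   Context: Graphs are finite and simple; $\Box$ denotes the Cartesian product of graphs; $C_n$ is the cycle with $n$ vertices. A layout of a graph $G$ is a cyclic ordering $\omega$ of its vertex set. Two edges conflict with respect to $\omega$ if their four endpoints occur in alternating order in $\omega$ (equivalently, the corresponding chords of a circle cross). Two distinct edges are adjacent if they share a vertex. A $k$-page matching book embedding is a triple $(G,\omega,c)$ where $\omega$ is a layout of $G$ and $c:E_G\to\{1,\dots,k\}$ is a surjection such that $c(e)\neq c(e')$ whenever $e$ and $e'$ are adjacent or conflict with respect to $\omega$. The matching book thickness $mbt(G)$ is the least $k$ for which some $k$-page matching book embedding $(G,\omega,c)$ exists (minimum over all layouts $\omega$). With $\Delta(G)$ the maximum degree of $G$, $G$ is nearly dispersable if $mbt(G)=1+\Delta(G)$. *)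

theory Defs
  imports Main
begin

section \<open>Finite simple graphs\<close>

record 'a ugraph =
  verts :: "'a set"
  edges :: "'a set set"

definition simple_graph :: "'a ugraph \<Rightarrow> bool" where
  "simple_graph G \<longleftrightarrow> finite (verts G) \<and> (\<forall>e\<in>edges G. e \<subseteq> verts G \<and> card e = 2)"

definition degree :: "'a ugraph \<Rightarrow> 'a \<Rightarrow> nat" where
  "degree G v = card {e \<in> edges G. v \<in> e}"

definition max_degree :: "'a ugraph \<Rightarrow> nat" where
  "max_degree G = Max (degree G ` verts G)"

text \<open>This is a simple graph, and the usual cycle, only for \<open>n \<ge> 3\<close>.\<close>

definition cycle_graph :: "nat \<Rightarrow> nat ugraph" where
  "cycle_graph n = \<lparr> verts = {..<n}, edges = {{i, (i + 1) mod n} | i. i < n} \<rparr>"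

definition box_product :: "'a ugraph \<Rightarrow> 'b ugraph \<Rightarrow> ('a \<times> 'b) ugraph" (infixl \<open>\<box>\<close> 70) where
  "G \<box> H =
    \<lparr> verts = verts G \<times> verts H,
      edges = {{(u, v), (u, v')} | u v v'. u \<in> verts G \<and> {v, v'} \<in> edges H}
            \<union> {{(u, v), (u', v)} | u u' v. {u, u'} \<in> edges G \<and> v \<in> verts H} \<rparr>"

section \<open>Layouts and matching book embeddings\<close>

text \<open>
  A layout is a strict cyclic order, given as a ternary relation: \<open>\<omega> a b c\<close> says that \<open>a\<close>, \<open>b\<close>,
  \<open>c\<close> are distinct and are met in this order when the circle is traversed in the positive
  direction. Distinctness follows from the first two axioms.
\<close>

definition layout :: "'a ugraph \<Rightarrow> ('a \<Rightarrow> 'a \<Rightarrow> 'a \<Rightarrow> bool) \<Rightarrow> bool" where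
  "layout G \<omega> \<longleftrightarrow>
    (\<forall>a\<in>verts G. \<forall>b\<in>verts G. \<forall>c\<in>verts G. \<omega> a b c \<longrightarrow> \<omega> b c a) \<and>
    (\<forall>a\<in>verts G. \<forall>b\<in>verts G. \<forall>c\<in>verts G. \<omega> a b c \<longrightarrow> \<not> \<omega> c b a) \<and>
    (\<forall>a\<in>verts G. \<forall>b\<in>verts G. \<forall>c\<in>verts G. \<forall>d\<in>verts G. \<omega> a b c \<longrightarrow> \<omega> a c d \<longrightarrow> \<omega> a b d) \<and>
    (\<forall>a\<in>verts G. \<forall>b\<in>verts G. \<forall>c\<in>verts G.
       a \<noteq> b \<longrightarrow> b \<noteq> c \<longrightarrow> a \<noteq> c \<longrightarrow> \<omega> a b c \<or> \<omega> c b a)"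

definition adjacent :: "'a set \<Rightarrow> 'a set \<Rightarrow> bool" where
  "adjacent e e' \<longleftrightarrow> e \<noteq> e' \<and> e \<inter> e' \<noteq> {}"

text \<open>The endpoints occur in the alternating cyclic order \<open>a\<close>, \<open>x\<close>, \<open>b\<close>, \<open>y\<close>.\<close>

definition conflict :: "('a \<Rightarrow> 'a \<Rightarrow> 'a \<Rightarrow> bool) \<Rightarrow> 'a set \<Rightarrow> 'a set \<Rightarrow> bool" where
  "conflict \<omega> e e' \<longleftrightarrow> (\<exists>a b x y. e = {a, b} \<and> e' = {x, y} \<and> \<omega> a x b \<and> \<omega> b y a)"

definition matching_book_embedding ::
    "nat \<Rightarrow> 'a ugraph \<Rightarrow> ('a \<Rightarrow> 'a \<Rightarrow> 'a \<Rightarrow> bool) \<Rightarrow> ('a set \<Rightarrow> nat) \<Rightarrow> bool" where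
  "matching_book_embedding k G \<omega> c \<longleftrightarrow>
    simple_graph G \<and> layout G \<omega> \<and> c ` edges G = {1..k} \<and>
    (\<forall>e\<in>edges G. \<forall>e'\<in>edges G. adjacent e e' \<or> conflict \<omega> e e' \<longrightarrow> c e \<noteq> c e')"

definition mbt :: "'a ugraph \<Rightarrow> nat" where
  "mbt G = (LEAST k. \<exists>\<omega> c. matching_book_embedding k G \<omega> c)"

definition nearly_dispersable :: "'a ugraph \<Rightarrow> bool" where
  "nearly_dispersable G \<longleftrightarrow> mbt G = 1 + max_degree G"

section \<open>Well-definedness\<close>

lemma simple_graph_cycle_graph:
  assumes "n \<ge> 3"
  shows "simple_graph (cycle_graph n)"
proof -
  have "i \<noteq> Suc i mod n" if "i < n" for i
    using that assms by (cases "Suc i = n") auto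
  then show ?thesis
    using assms by (fastforce simp: simple_graph_def cycle_graph_def card_2_iff)
qed

lemma simple_graph_box_product:
  assumes "simple_graph G" "simple_graph H"
  shows "simple_graph (G \<box> H)"
proof -
  have G: "u \<noteq> u' \<and> u \<in> verts G \<and> u' \<in> verts G" if "{u, u'} \<in> edges G" for u u'
    using assms(1) that by (cases "u = u'") (auto simp: simple_graph_def)
  have H: "u \<noteq> u' \<and> u \<in> verts H \<and> u' \<in> verts H" if "{u, u'} \<in> edges H" for u u'
    using assms(2) that by (cases "u = u'") (auto simp: simple_graph_def)
  have "finite (verts (G \<box> H))"
    using assms by (simp add: simple_graph_def box_product_def)
  moreover have "e \<subseteq> verts (G \<box> H) \<and> card e = 2" if "e \<in> edges (G \<box> H)" for e
    using that by (auto simp: box_product_def dest: G H)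
  ultimately show ?thesis
    by (simp add: simple_graph_def)
qed

lemma layout_of_positions:
  fixes p :: "'a \<Rightarrow> nat"
  assumes "inj_on p (verts G)"
  shows "layout G (\<lambda>a b c. (p a < p b \<and> p b < p c) \<or> (p b < p c \<and> p c < p a) \<or> (p c < p a \<and> p a < p b))"
proof -
  have neq: "p a \<noteq> p b" if "a \<in> verts G" "b \<in> verts G" "a \<noteq> b" for a b
    using assms that by (auto dest: inj_onD)
  show ?thesis
    unfolding layout_def
    apply (intro conjI ballI impI)
    subgoal by linarith
    subgoal by linarith
    subgoal by linarith
    subgoal for a b c using neq[of a b] neq[of b c] neq[of a c] by linarith
    done
qed

text \<open>The set minimised in \<^const>\<open>mbt\<close> is nonempty, so the minimum is attained.\<close>

lemma matching_book_embedding_exists: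
  assumes G: "simple_graph G"
  shows "\<exists>k \<omega> c. matching_book_embedding k G \<omega> c"
proof -
  have fin: "finite (verts G)"
    using G by (simp add: simple_graph_def)
  have "edges G \<subseteq> Pow (verts G)"
    using G by (auto simp: simple_graph_def)
  then have finE: "finite (edges G)"
    using fin by (meson finite_Pow_iff finite_subset)
  obtain p :: "'a \<Rightarrow> nat" where "inj_on p (verts G)"
    using finite_imp_inj_to_nat_seg[OF fin] by blast
  from layout_of_positions[OF this] obtain \<omega> where l: "layout G \<omega>"
    by blast
  obtain c where c: "bij_betw c (edges G) {1..card (edges G)}"
    using finite_same_card_bij[OF finE, of "{1..card (edges G)}"] by auto
  have "e \<noteq> e'" if "e \<in> edges G" "conflict \<omega> e e'" for e e'
  proof
    assume "e = e'"
    with that(2) obtain a b x y where *: "e = {a, b}" "e = {x, y}" "\<omega> a x b"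
      by (auto simp: conflict_def)
    then have ab: "a \<in> verts G" "b \<in> verts G" and x: "x = a \<or> x = b"
      using G that(1) by (auto simp: simple_graph_def doubleton_eq_iff)
    have "\<omega> u v w \<longrightarrow> \<omega> v w u \<and> \<not> \<omega> w v u"
      if "u \<in> verts G" "v \<in> verts G" "w \<in> verts G" for u v w
      using l that unfolding layout_def by blast
    then show False
      using * ab x by metis
  qed
  then have "matching_book_embedding (card (edges G)) G \<omega> c"
    using G l c unfolding matching_book_embedding_def bij_betw_def adjacent_def
    by (metis inj_onD)
  then show ?thesis
    by blast
qed

end

theory Submission
  imports Defs
begin

text \<open>
  The product \<open>C\<^sub>5 \<box> C\<^sub>n\<close> is regular of degree 4, so the claim is that five pages suffice and four do
  not.

  Four pages do not suffice because a regular graph that can be embedded with as many pages as its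
  degree is bipartite (\<open>bipartite_if_pages_le_degree\<close>). Every vertex then meets every page, so each
  page is a perfect matching without crossings. The vertices strictly between the ends of an edge
  are matched among themselves by the page of that edge, hence their number is even. Along the
  layout, every edge therefore joins an even place to an odd one. The fibres \<open>C\<^sub>5\<close> are odd cycles, so
  this is impossible for \<open>C\<^sub>5 \<box> C\<^sub>n\<close>.

  For five pages, cut the circle open and let the columns (the copies of \<open>C\<^sub>5\<close>) occupy
  consecutive blocks of five places, every second block in reversed order. The edges inside the
  blocks fit on pages 1, 2 and 3. The edges between consecutive blocks form nested quintuples, which
  go alternately to pages 4 and 5 (\<open>strip_page\<close>). If \<open>n\<close> is even, then the edges between the last
  column and the first form one more nested quintuple, which encloses everything else on page 5
  (\<open>five_pages_even\<close>). If \<open>n\<close> is odd, this fails twice: the last block is not reversed, so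
  its edges to the first cross each other, and on page 4 or 5 they meet other edges of that page
  at a vertex. Then only \<open>n - 2\<close> columns are laid out as blocks, and
  the last two are interleaved on the remaining ten places (\<open>tail_place\<close>, \<open>tail_page\<close>,
  \<open>five_pages_odd\<close>). The strip can be lengthened by two blocks at a time because all edges leaving its
  first block for the tail lie on page 5 and all edges leaving its last block for the tail lie on
  page 4. So a single explicit closing, an embedding of \<open>C\<^sub>5 \<box> C\<^sub>3\<close>, serves all odd \<open>n\<close>.
\<close>

section \<open>Regular graphs with as many pages as the degree\<close>

definition proper_pages :: "'a ugraph \<Rightarrow> ('a \<Rightarrow> 'a \<Rightarrow> 'a \<Rightarrow> bool) \<Rightarrow> ('a set \<Rightarrow> nat) \<Rightarrow> bool" where
  "proper_pages G \<omega> c \<longleftrightarrow>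
    (\<forall>e\<in>edges G. \<forall>e'\<in>edges G. adjacent e e' \<or> conflict \<omega> e e' \<longrightarrow> c e \<noteq> c e')"

lemma finite_edges:
  assumes "simple_graph G"
  shows "finite (edges G)"
proof -
  have "edges G \<subseteq> Pow (verts G)" "finite (verts G)"
    using assms by (auto simp: simple_graph_def)
  then show ?thesis
    by (meson finite_Pow_iff finite_subset)
qed

lemma edge_verts:
  assumes "simple_graph G" "{a, b} \<in> edges G"
  shows "a \<in> verts G" "b \<in> verts G" "a \<noteq> b"
proof -
  have "{a, b} \<subseteq> verts G" "card {a, b} = 2"
    using assms unfolding simple_graph_def by blast+
  then show "a \<in> verts G" "b \<in> verts G" "a \<noteq> b"
    by auto
qed

lemma edge_at_vertexE:
  assumes "simple_graph G" "e \<in> edges G" "x \<in> e"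
  obtains y where "e = {x, y}" "y \<noteq> x"
proof -
  have "card e = 2"
    using assms(1,2) unfolding simple_graph_def by blast
  then obtain a b where "e = {a, b}" "a \<noteq> b"
    unfolding card_2_iff by metis
  with assms(3) show ?thesis
    using that[of a] that[of b] by (auto simp: insert_commute)
qed

lemma edgeE:
  assumes "simple_graph G" "e \<in> edges G"
  obtains a b where "e = {a, b}" "a \<noteq> b"
proof -
  have "card e = 2"
    using assms unfolding simple_graph_def by blast
  then show ?thesis
    using that unfolding card_2_iff by blast
qed

lemma layoutD:
  assumes "layout G \<omega>" "a \<in> verts G" "b \<in> verts G" "c \<in> verts G"
  shows layout_cyclic: "\<omega> a b c \<Longrightarrow> \<omega> b c a"
    and layout_asym: "\<omega> a b c \<Longrightarrow> \<not> \<omega> c b a"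
    and layout_total: "a \<noteq> b \<Longrightarrow> b \<noteq> c \<Longrightarrow> a \<noteq> c \<Longrightarrow> \<omega> a b c \<or> \<omega> c b a"
    and layout_trans: "d \<in> verts G \<Longrightarrow> \<omega> a b c \<Longrightarrow> \<omega> a c d \<Longrightarrow> \<omega> a b d"
  using assms unfolding layout_def by blast+

lemma layout_distinct:
  assumes l: "layout G \<omega>" and V: "a \<in> verts G" "b \<in> verts G" "c \<in> verts G"
    and abc: "\<omega> a b c"
  shows "a \<noteq> b" "b \<noteq> c" "a \<noteq> c"
proof -
  have bca: "\<omega> b c a"
    using layout_cyclic[OF l V abc] .
  show "a \<noteq> c"
    using layout_asym[OF l V abc] abc by auto
  show "a \<noteq> b"
    using layout_asym[OF l V(2,3,1) bca] bca by auto
  show "b \<noteq> c"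
    using layout_asym[OF l V(3,1,2)] layout_cyclic[OF l V(2,3,1) bca] by auto
qed

lemma proper_pages_inj_on_star:
  assumes "proper_pages G \<omega> c"
  shows "inj_on c {e \<in> edges G. v \<in> e}"
  using assms unfolding inj_on_def proper_pages_def adjacent_def by blast

text \<open>
  The edges at \<open>v\<close> have distinct pages, and there are no more pages than edges at \<open>v\<close>.
\<close>

lemma every_page_at_vertex:
  assumes G: "simple_graph G" and c: "proper_pages G \<omega> c"
    and "card (c ` edges G) \<le> degree G v" and k: "k \<in> c ` edges G"
  obtains e where "e \<in> edges G" "v \<in> e" "c e = k"
proof -
  let ?S = "{e \<in> edges G. v \<in> e}"
  have "c ` ?S = c ` edges G"
    using assms(3) finite_edges[OF G] card_image[OF proper_pages_inj_on_star[OF c, of v]]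
    by (intro card_seteq) (auto simp: degree_def)
  then show ?thesis
    using k that by (metis (mono_tags, lifting) imageE mem_Collect_eq)
qed

text \<open>
  On the page of \<open>{a, b}\<close>, a vertex between \<open>a\<close> and \<open>b\<close> has a partner. The partner is neither \<open>a\<close> nor
  \<open>b\<close>, since these are taken, and not beyond them, since the edge would cross \<open>{a, b}\<close>. So the vertices
  between \<open>a\<close> and \<open>b\<close> come in pairs.
\<close>

lemma even_card_between:
  assumes G: "simple_graph G" and l: "layout G \<omega>" and c: "proper_pages G \<omega> c"
    and deg: "\<And>v. v \<in> verts G \<Longrightarrow> card (c ` edges G) \<le> degree G v"
    and e: "{a, b} \<in> edges G"
  shows "even (card {x \<in> verts G. \<omega> a x b})"
proof -
  define S where "S = {x \<in> verts G. \<omega> a x b}"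
  define M where "M = {e \<in> edges G. c e = c {a, b} \<and> e \<subseteq> S}"
  note ab = edge_verts[OF G e]
  have "\<exists>e'\<in>M. x \<in> e'" if "x \<in> S" for x
  proof -
    have x: "x \<in> verts G" "\<omega> a x b" "x \<noteq> a" "x \<noteq> b"
      using that layout_distinct[OF l] ab unfolding S_def by blast+
    obtain e' where e': "e' \<in> edges G" "x \<in> e'" "c e' = c {a, b}"
      using every_page_at_vertex[OF G c deg[OF x(1)]] e by blast
    obtain y where y: "e' = {x, y}"
      using edge_at_vertexE[OF G e'(1,2)] by blast
    have "e' \<noteq> {a, b}"
      using e' x by auto
    then have "e' \<inter> {a, b} = {}"
      using c e e' unfolding proper_pages_def adjacent_def by metis
    then have yab: "y \<in> verts G" "y \<noteq> a" "y \<noteq> b"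
      using y e' edge_verts[OF G] by auto
    have "\<not> \<omega> b y a"
    proof
      assume "\<omega> b y a"
      then have "conflict \<omega> {a, b} e'"
        using x y unfolding conflict_def by blast
      then show False
        using c e e' unfolding proper_pages_def by metis
    qed
    then have "\<omega> a y b"
      using layout_total[OF l ab(1) yab(1) ab(2)] ab yab by blast
    then show ?thesis
      using e' y yab that unfolding M_def S_def by blast
  qed
  then have S: "S = \<Union>M"
    unfolding M_def by blast
  have fin: "finite M"
    using finite_edges[OF G] unfolding M_def by simp
  have disj: "pairwise disjnt M"
  proof (rule pairwiseI)
    fix e1 e2 assume "e1 \<in> M" "e2 \<in> M" "e1 \<noteq> e2"
    then have "\<not> adjacent e1 e2"
      using c unfolding M_def proper_pages_def by fastforce
    then show "disjnt e1 e2"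
      using \<open>e1 \<noteq> e2\<close> unfolding adjacent_def disjnt_def by blast
  qed
  have two: "card e' = 2" "finite e'" if "e' \<in> M" for e'
  proof -
    show "card e' = 2"
      using that G unfolding M_def simple_graph_def by blast
    then show "finite e'"
      by (simp add: card_ge_0_finite)
  qed
  have "card S = (\<Sum>e'\<in>M. card e')"
    unfolding S using disj two by (intro card_Union_disjoint) auto
  also have "\<dots> = 2 * card M"
    using two by simp
  finally show ?thesis
    unfolding S_def by simp
qed

text \<open>
  This makes the number of vertices between \<open>r\<close> and \<open>x\<close> a position of \<open>x\<close>: opening the circle at \<open>r\<close>
  turns the cyclic order into a linear one.
\<close>

lemma card_between_add:
  assumes G: "simple_graph G" and l: "layout G \<omega>"
    and V: "r \<in> verts G" "a \<in> verts G" "b \<in> verts G" and rab: "\<omega> r a b"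
  shows "card {x \<in> verts G. \<omega> r x b} =
    Suc (card {x \<in> verts G. \<omega> r x a} + card {x \<in> verts G. \<omega> a x b})"
proof -
  let ?R = "{x \<in> verts G. \<omega> r x a}" and ?S = "{x \<in> verts G. \<omega> a x b}"
  have fin: "finite (verts G)"
    using G unfolding simple_graph_def by blast
  have 1: "\<omega> r x b" if "x \<in> verts G" "\<omega> r x a" for x
    using layout_trans[OF l V(1) that(1) V(2) V(3) that(2) rab] .
  have 2: "\<omega> r x b" if "x \<in> verts G" "\<omega> a x b" for x
    using layout_trans[OF l V(3) V(1) V(2) that(1)] layout_cyclic[OF l] that V rab by blast
  have 3: "\<omega> a x b" if "x \<in> verts G" "\<omega> r x b" "x \<noteq> a" "\<not> \<omega> r x a" for x
  proof -
    have "x \<noteq> r" "a \<noteq> r"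
      using layout_distinct[OF l] that V rab by blast+
    then have "\<omega> a x r"
      using layout_total[OF l V(1) that(1) V(2)] that by blast
    then show ?thesis
      using layout_trans[OF l that(1) V(3) V(1) V(2)] layout_cyclic[OF l] that V by blast
  qed
  have 4: "\<not> \<omega> a x b" if "x \<in> verts G" "\<omega> r x a" for x
    using layout_trans[OF l V(2) that(1) V(3) V(1)] layout_cyclic[OF l] layout_asym[OF l] that V rab
    by blast
  have "{x \<in> verts G. \<omega> r x b} = insert a (?R \<union> ?S)"
    using 1 2 3 V rab by blast
  moreover have "a \<notin> ?R \<union> ?S" "?R \<inter> ?S = {}"
    using 4 layout_distinct[OF l] V by blast+
  ultimately show ?thesis
    using fin by (simp add: card_Un_disjoint)
qed

text \<open>
  Colour each vertex by the parity of its position after the base vertex \<open>r\<close>. By the two lemmas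
  above, the positions of the ends of an edge differ by an odd number.
\<close>

lemma bipartite_if_pages_le_degree:
  assumes G: "simple_graph G" and l: "layout G \<omega>" and c: "proper_pages G \<omega> c"
    and deg: "\<And>v. v \<in> verts G \<Longrightarrow> card (c ` edges G) \<le> degree G v"
  shows "\<exists>f :: 'a \<Rightarrow> bool. \<forall>a b. {a, b} \<in> edges G \<longrightarrow> f a \<noteq> f b"
proof (cases "verts G = {}")
  case True
  then show ?thesis
    using edge_verts[OF G] by blast
next
  case False
  then obtain r where r: "r \<in> verts G"
    by blast
  \<comment> \<open>The position of \<open>x \<noteq> r\<close> is one more than the number counted here, and that of \<open>r\<close> is 0; so \<open>f\<close>
    holds at the even positions.\<close>
  define f where "f x \<longleftrightarrow> x = r \<or> odd (card {y \<in> verts G. \<omega> r y x})" for x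
  have ev: "even (card {x \<in> verts G. \<omega> a x b})" if "{a, b} \<in> edges G" for a b
    using even_card_between[OF G l c deg that] .
  have step: "f a \<noteq> f b" if "{a, b} \<in> edges G" "\<omega> r a b" for a b
    using card_between_add[OF G l r _ _ that(2)] ev[OF that(1)] edge_verts[OF G that(1)]
      layout_distinct[OF l r _ _ that(2)]
    unfolding f_def by auto
  have "f a \<noteq> f b" if e: "{a, b} \<in> edges G" for a b
  proof -
    note ab = edge_verts[OF G e]
    have e': "{b, a} \<in> edges G"
      using e by (simp add: insert_commute)
    consider "a = r" | "b = r" | "a \<noteq> r" "b \<noteq> r" by blast
    then show ?thesis
    proof cases
      case 1
      then show ?thesis using ev[OF e] ab unfolding f_def by simp
    next
      case 2
      then show ?thesis using ev[OF e'] ab unfolding f_def by simp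
    next
      case 3
      then have "\<omega> r a b \<or> \<omega> r b a"
        using layout_total[OF l r ab(1,2)] layout_cyclic[OF l] ab r by blast
      then show ?thesis
        using step[OF e] step[OF e'] by blast
    qed
  qed
  then show ?thesis by blast
qed

section \<open>Degrees in products of cycles\<close>

lemma verts_cycle_graph [simp]: "verts (cycle_graph n) = {..<n}"
  by (simp add: cycle_graph_def)

lemma verts_box_product [simp]: "verts (G \<box> H) = verts G \<times> verts H"
  by (simp add: box_product_def)

lemma degree_cycle_graph:
  assumes "n \<ge> 3" "i < n"
  shows "degree (cycle_graph n) i = 2"
proof -
  \<comment> \<open>\<open>s\<close> is the successor on the cycle and \<open>q\<close> the predecessor of \<open>i\<close>, both without \<open>mod\<close>.\<close>
  define s where "s j = (if Suc j = n then 0 else Suc j)" for j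
  have s: "(j + 1) mod n = s j" if "j < n" for j
    using that unfolding s_def by (cases "Suc j = n") simp_all
  define q where "q = (if i = 0 then n - 1 else i - 1)"
  have "{e \<in> edges (cycle_graph n). i \<in> e} = {{i, s i}, {q, i}}"
  proof -
    have "edges (cycle_graph n) = {{j, s j} | j. j < n}"
      unfolding cycle_graph_def using s by (simp cong: conj_cong) metis
    moreover have q: "q < n" "s q = i"
      using assms unfolding s_def q_def by auto
    moreover have "j = q" if "j < n" "s j = i" for j
      using that unfolding s_def q_def by (simp split: if_splits)
    ultimately have "e \<in> edges (cycle_graph n) \<and> i \<in> e \<longleftrightarrow> (\<exists>j. e = {j, s j} \<and> (j = i \<or> j = q))"
      for e
      using assms(2) by (smt (verit, best) insertE insertI1 insertI2 mem_Collect_eq singletonD)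
    then show ?thesis
      using q(2) by auto
  qed
  moreover have "{i, s i} \<noteq> {q, i}"
    using assms unfolding s_def q_def by (auto simp: doubleton_eq_iff split: if_splits)
  ultimately show ?thesis
    unfolding degree_def by simp
qed

lemma degree_box_product:
  assumes G: "simple_graph G" and H: "simple_graph H"
    and u: "u \<in> verts G" and v: "v \<in> verts H"
  shows "degree (G \<box> H) (u, v) = degree G u + degree H v"
proof -
  let ?A = "{e \<in> edges G. u \<in> e}" and ?B = "{e \<in> edges H. v \<in> e}"
  let ?f = "(\<lambda>e. (\<lambda>x. (x, v)) ` e)" and ?g = "(\<lambda>e. Pair u ` e)"
  have pair: "\<exists>a b. e = {a, b} \<and> a \<noteq> b" if "e \<in> edges G" for e
    using edgeE[OF G that] by metis
  have pair': "\<exists>a b. e = {a, b} \<and> a \<noteq> b" if "e \<in> edges H" for e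
    using edgeE[OF H that] by metis
  have sub: "?f ` ?A \<union> ?g ` ?B \<subseteq> {e \<in> edges (G \<box> H). (u, v) \<in> e}"
  proof -
    have "?f e \<in> edges (G \<box> H)" if "e \<in> edges G" for e
      using pair[OF that] that v unfolding box_product_def by auto
    moreover have "?g e \<in> edges (G \<box> H)" if "e \<in> edges H" for e
      using pair'[OF that] that u unfolding box_product_def by auto
    ultimately show ?thesis by auto
  qed
  have sup: "{e \<in> edges (G \<box> H). (u, v) \<in> e} \<subseteq> ?f ` ?A \<union> ?g ` ?B"
  proof
    fix e assume e: "e \<in> {e \<in> edges (G \<box> H). (u, v) \<in> e}"
    then consider w x x' where "e = {(w, x), (w, x')}" "{x, x'} \<in> edges H"
      | w w' x where "e = {(w, x), (w', x)}" "{w, w'} \<in> edges G"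
      unfolding box_product_def by auto
    then show "e \<in> ?f ` ?A \<union> ?g ` ?B"
    proof cases
      case 1
      then have "e = ?g {x, x'}" "v \<in> {x, x'}" using e by auto
      then show ?thesis using 1 by blast
    next
      case 2
      then have "e = ?f {w, w'}" "u \<in> {w, w'}" using e by auto
      then show ?thesis using 2 by blast
    qed
  qed
  have "?f ` ?A \<inter> ?g ` ?B = {}"
  proof -
    have False if "e \<in> ?A" "?f e = ?g e'" for e e'
    proof -
      have "e \<in> edges G" "u \<in> e"
        using that(1) by simp_all
      then obtain w where "w \<in> e" "w \<noteq> u"
        using edge_at_vertexE[OF G] by blast
      then have "(w, v) \<in> ?g e'"
        using that(2) by blast
      then show False using \<open>w \<noteq> u\<close> by auto
    qed
    then show ?thesis by blast
  qed
  moreover have "inj_on ?f ?A" "inj_on ?g ?B"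
    by (auto simp: inj_on_def inj_image_eq_iff)
  moreover have "finite ?A" "finite ?B"
    using finite_edges[OF G] finite_edges[OF H] by simp_all
  moreover have "{e \<in> edges (G \<box> H). (u, v) \<in> e} = ?f ` ?A \<union> ?g ` ?B"
    using sub sup by blast
  ultimately show ?thesis
    unfolding degree_def by (simp add: card_Un_disjoint card_image)
qed

lemma five_cycle_fibre_edge:
  assumes "v \<in> verts H" "u < 5"
  shows "{(u, v), ((u + 1) mod 5, v)} \<in> edges (cycle_graph 5 \<box> H)"
proof -
  have "{u, (u + 1) mod 5} \<in> edges (cycle_graph 5)"
    using assms(2) unfolding cycle_graph_def by auto
  then show ?thesis
    using assms(1) unfolding box_product_def by (simp only: ugraph.simps) blast
qed

lemma five_cycle_product_not_bipartite:
  assumes "v \<in> verts H"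
  shows "\<nexists>f :: nat \<times> 'a \<Rightarrow> bool. \<forall>a b. {a, b} \<in> edges (cycle_graph 5 \<box> H) \<longrightarrow> f a \<noteq> f b"
proof
  assume "\<exists>f :: nat \<times> 'a \<Rightarrow> bool. \<forall>a b. {a, b} \<in> edges (cycle_graph 5 \<box> H) \<longrightarrow> f a \<noteq> f b"
  then obtain f :: "nat \<times> 'a \<Rightarrow> bool"
    where f: "\<And>a b. {a, b} \<in> edges (cycle_graph 5 \<box> H) \<Longrightarrow> f a \<noteq> f b"
    by blast
  have "f (u, v) \<noteq> f ((u + 1) mod 5, v)" if "u < 5" for u
    using f five_cycle_fibre_edge[OF assms that] .
  from this[of 0] this[of 1] this[of 2] this[of 3] this[of 4] show False
    by (simp add: numeral_2_eq_2)
qed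

section \<open>Pages as families of arcs over a line\<close>

text \<open>
  A page is described by the places that its edges join, each pair listed in increasing order. Two
  different arcs of a page are disjoint intervals or one lies strictly inside the other; that the
  inequalities are strict says that no two arcs share an end.
\<close>

definition noncrossing_matching :: "(nat \<times> nat) set \<Rightarrow> bool" where
  "noncrossing_matching A \<longleftrightarrow> (\<forall>(i, j)\<in>A. i < j) \<and>
    (\<forall>(i, j)\<in>A. \<forall>(k, l)\<in>A.
      (i, j) = (k, l) \<or> j < k \<or> l < i \<or> i < k \<and> l < j \<or> k < i \<and> j < l)"

lemma noncrossing_matchingD:
  assumes "noncrossing_matching A" "(i, j) \<in> A"
  shows "i < j"
    and "(k, l) \<in> A \<Longrightarrow> (i, j) = (k, l) \<or> j < k \<or> l < i \<or> i < k \<and> l < j \<or> k < i \<and> j < l"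
  using assms unfolding noncrossing_matching_def by blast+

lemma noncrossing_matchingI:
  assumes "\<And>i j. (i, j) \<in> A \<Longrightarrow> i < j"
    and "\<And>i j k l. (i, j) \<in> A \<Longrightarrow> (k, l) \<in> A \<Longrightarrow> i \<le> k \<Longrightarrow> (i, j) = (k, l) \<or> j < k \<or> i < k \<and> l < j"
  shows "noncrossing_matching A"
proof -
  have "(i, j) = (k, l) \<or> j < k \<or> l < i \<or> i < k \<and> l < j \<or> k < i \<and> j < l"
    if "(i, j) \<in> A" "(k, l) \<in> A" for i j k l
    using assms(2)[OF that] assms(2)[OF that(2,1)] by (cases i k rule: le_cases) auto
  then show ?thesis
    using assms(1) unfolding noncrossing_matching_def by blast
qed

definition lies_on :: "('a \<Rightarrow> nat) \<Rightarrow> (nat \<times> nat) set \<Rightarrow> 'a set \<Rightarrow> bool" where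
  "lies_on p A e \<longleftrightarrow> (\<exists>a b. e = {a, b} \<and> (p a, p b) \<in> A)"

lemma lies_onI:
  assumes "(p a, p b) \<in> A \<or> (p b, p a) \<in> A"
  shows "lies_on p A {a, b}"
  using assms unfolding lies_on_def by (metis insert_commute)

text \<open>
  It suffices to place the vertices injectively on a line and to cover all edges by noncrossing
  matchings of the places: closing the line to a circle creates no conflicts, since crossing of
  chords is crossing of the corresponding intervals.
\<close>

lemma proper_pages_of_arcs:
  assumes G: "simple_graph G" and inj: "inj_on p (verts G)"
    and nc: "\<And>k. k \<in> K \<Longrightarrow> noncrossing_matching (page k)"
    and cover: "\<And>e. e \<in> edges G \<Longrightarrow> \<exists>k\<in>K. lies_on p (page k) e"
  shows "\<exists>\<omega> c. layout G \<omega> \<and> c ` edges G \<subseteq> K \<and> proper_pages G \<omega> c"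
proof -
  define \<omega> where "\<omega> = (\<lambda>a b c. (p a < p b \<and> p b < p c) \<or> (p b < p c \<and> p c < p a)
    \<or> (p c < p a \<and> p a < p b))"
  obtain c where c: "\<And>e. e \<in> edges G \<Longrightarrow> c e \<in> K \<and> lies_on p (page (c e)) e"
    using cover by metis
  have "c e \<noteq> c e'" if E: "e \<in> edges G" "e' \<in> edges G" and ac: "adjacent e e' \<or> conflict \<omega> e e'"
    for e e'
  proof
    assume eq: "c e = c e'"
    obtain a b where e: "e = {a, b}" "(p a, p b) \<in> page (c e)"
      using c[OF E(1)] unfolding lies_on_def by blast
    obtain x y where e': "e' = {x, y}" "(p x, p y) \<in> page (c e)"
      using c[OF E(2)] eq unfolding lies_on_def by auto
    have nc: "noncrossing_matching (page (c e))"
      using nc c[OF E(1)] by blast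
    have "{a, b} \<in> edges G" "{x, y} \<in> edges G"
      using e e' E by simp_all
    note V = edge_verts[OF G this(1)] edge_verts[OF G this(2)]
    have lt: "p a < p b" "p x < p y"
      using noncrossing_matchingD(1)[OF nc] e(2) e'(2) by simp_all
    consider "p a = p x" "p b = p y"
      | "p b < p x \<or> p y < p a \<or> p a < p x \<and> p y < p b \<or> p x < p a \<and> p b < p y"
      using noncrossing_matchingD(2)[OF nc e(2) e'(2)] by blast
    then show False
    proof cases
      case 1
      then have "a = x" "b = y"
        using inj_onD[OF inj] V by simp_all
      then have "conflict \<omega> {a, b} {a, b}"
        using ac e(1) e'(1) unfolding adjacent_def by simp
      then show False
        unfolding conflict_def \<omega>_def by (auto simp: doubleton_eq_iff)
    next
      case 2
      then have "\<not> adjacent e e'"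
        using e(1) e'(1) lt unfolding adjacent_def by auto
      then obtain a' b' x' y' where "{a, b} = {a', b'}" "{x, y} = {x', y'}"
        "\<omega> a' x' b'" "\<omega> b' y' a'"
        using ac e(1) e'(1) unfolding conflict_def by metis
      then show False
        using 2 lt unfolding \<omega>_def doubleton_eq_iff by (elim disjE conjE; simp)
    qed
  qed
  moreover have "layout G \<omega>"
    unfolding \<omega>_def using layout_of_positions[OF inj] .
  moreover have "c ` edges G \<subseteq> K"
    using c by blast
  ultimately show ?thesis
    unfolding proper_pages_def by blast
qed

text \<open>
  An arc with both ends outside the interval \<open>[s, t)\<close> is disjoint from it or encloses it.
\<close>

lemma noncrossing_matching_Un:
  assumes A: "noncrossing_matching A" and B: "noncrossing_matching B"
    and "A \<subseteq> {s..<t} \<times> {s..<t}" "B \<subseteq> (- {s..<t}) \<times> (- {s..<t})"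
  shows "noncrossing_matching (A \<union> B)"
proof -
  have AB: "j < k \<or> l < i \<or> i < k \<and> l < j \<or> k < i \<and> j < l"
    if "(i, j) \<in> A" "(k, l) \<in> B" for i j k l
    using subsetD[OF assms(3) that(1)] subsetD[OF assms(4) that(2)]
      noncrossing_matchingD(1)[OF A that(1)] noncrossing_matchingD(1)[OF B that(2)]
    by auto
  show ?thesis
  proof (rule noncrossing_matchingI)
    fix i j assume "(i, j) \<in> A \<union> B"
    then show "i < j"
      using noncrossing_matchingD(1)[OF A] noncrossing_matchingD(1)[OF B] by blast
  next
    fix i j k l assume ij: "(i, j) \<in> A \<union> B" and kl: "(k, l) \<in> A \<union> B" and "i \<le> k"
    have "i < j" "k < l"
      using ij kl noncrossing_matchingD(1)[OF A] noncrossing_matchingD(1)[OF B] by blast+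
    moreover have "(i, j) = (k, l) \<or> j < k \<or> l < i \<or> i < k \<and> l < j \<or> k < i \<and> j < l"
      using ij kl AB[of i j k l] AB[of k l i j] noncrossing_matchingD(2)[OF A, of i j k l]
        noncrossing_matchingD(2)[OF B, of i j k l] by blast
    ultimately show "(i, j) = (k, l) \<or> j < k \<or> i < k \<and> l < j"
      using \<open>i \<le> k\<close> by linarith
  qed
qed

section \<open>The strip of alternately reversed blocks\<close>

text \<open>
  A vertex \<open>(u, v)\<close> lies in row \<open>u\<close> and column \<open>v\<close>. The rows of an even column are ordered
  0, 1, 3, 2, 4, and those of an odd column in reverse. This order is chosen to fit
  the arcs of \<open>tail_page\<close>; in it, the five edges of a column need three pages.
\<close>

definition block_place :: "nat \<Rightarrow> nat \<Rightarrow> nat" where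
  "block_place v u = (if even v then [0, 1, 3, 2, 4] ! u else [4, 3, 1, 2, 0] ! u)"

text \<open>
  The places within a block joined on page \<open>k\<close>. On every page but the second the two
  parities of \<open>v\<close> are mirror images; the second page is its own mirror image.
\<close>

definition block_arcs :: "nat \<Rightarrow> nat \<Rightarrow> (nat \<times> nat) set" where
  "block_arcs k v =
    (if k = 1 then if even v then {(0, 1), (2, 3)} else {(1, 2), (3, 4)}
     else if k = 2 then {(0, 4), (1, 3)}
     else if k = 3 then if even v then {(2, 4)} else {(0, 2)}
     else {})"

definition strip_place :: "nat \<times> nat \<Rightarrow> nat" where
  "strip_place = (\<lambda>(u, v). 5 * v + block_place v u)"

text \<open>
  Places \<open>5v + i\<close> and \<open>5v + 9 - i\<close> are symmetric about the boundary between the blocks \<open>v\<close> and \<open>v + 1\<close>.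
  Since these blocks are in opposite order, they hold the two ends of an edge between the columns.
\<close>

definition strip_page :: "nat \<Rightarrow> nat \<Rightarrow> (nat \<times> nat) set" where
  "strip_page m k =
    {(5 * v + i, 5 * v + j) | v i j. v < m \<and> (i, j) \<in> block_arcs k v}
    \<union> {(5 * v + i, 5 * v + 9 - i) | v i. Suc v < m \<and> i < 5 \<and> k = (if even v then 4 else 5)}"

lemma less_5_cases: "(u :: nat) < 5 \<longleftrightarrow> u = 0 \<or> u = 1 \<or> u = 2 \<or> u = 3 \<or> u = 4"
  by auto

lemma block_place_less: "u < 5 \<Longrightarrow> block_place v u < 5"
  unfolding less_5_cases block_place_def by auto

lemma block_arcs_less: "(i, j) \<in> block_arcs k v \<Longrightarrow> i < 5 \<and> j < 5"
  unfolding block_arcs_def by (auto split: if_splits)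

lemma noncrossing_block_arcs: "noncrossing_matching (block_arcs k v)"
  unfolding block_arcs_def noncrossing_matching_def by auto

lemma inj_on_strip_place: "inj_on strip_place ({..<5} \<times> UNIV)"
proof (rule inj_onI)
  fix a b assume ab: "a \<in> {..<5} \<times> UNIV" "b \<in> {..<5} \<times> UNIV" and eq: "strip_place a = strip_place b"
  obtain u v u' v' where [simp]: "a = (u, v)" "b = (u', v')"
    by (metis surj_pair)
  have u: "u < 5" "u' < 5"
    using ab by auto
  have eq: "5 * v + block_place v u = 5 * v' + block_place v' u'"
    using eq unfolding strip_place_def by simp
  have v: "v = v'"
    using eq block_place_less[OF u(1), of v] block_place_less[OF u(2), of v'] by linarith
  then have "block_place v u = block_place v u'"
    using eq by simp
  then have "u = u'"
    using u unfolding less_5_cases block_place_def by (auto split: if_splits)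
  with v show "a = b" by simp
qed

text \<open>
  On pages 1, 2 and 3 every arc stays inside a block. On pages 4 and 5 the quintuples occupy disjoint
  pairs of blocks, because their indices \<open>v\<close> have the same parity.
\<close>

lemma noncrossing_strip_page: "noncrossing_matching (strip_page m k)"
proof (cases "k \<in> {1, 2, 3}")
  case True
  then have page: "strip_page m k = {(5 * v + i, 5 * v + j) | v i j. v < m \<and> (i, j) \<in> block_arcs k v}"
    unfolding strip_page_def by auto
  show ?thesis
    unfolding page
  proof (rule noncrossing_matchingI)
    fix x y assume "(x, y) \<in> {(5 * v + i, 5 * v + j) | v i j. v < m \<and> (i, j) \<in> block_arcs k v}"
    then show "x < y"
      using noncrossing_matchingD(1)[OF noncrossing_block_arcs] by auto
  next
    fix x y x' y'
    assume "(x, y) \<in> {(5 * v + i, 5 * v + j) | v i j. v < m \<and> (i, j) \<in> block_arcs k v}"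
      "(x', y') \<in> {(5 * v + i, 5 * v + j) | v i j. v < m \<and> (i, j) \<in> block_arcs k v}"
    then obtain v i j v' i' j' where xy: "x = 5 * v + i" "y = 5 * v + j" "x' = 5 * v' + i'" "y' = 5 * v' + j'"
      and arcs: "(i, j) \<in> block_arcs k v" "(i', j') \<in> block_arcs k v'"
      by auto
    assume "x \<le> x'"
    have less: "i < 5" "j < 5" "i' < 5" "j' < 5"
      using arcs block_arcs_less by blast+
    then have "v < v' \<or> v = v'"
      using \<open>x \<le> x'\<close> xy by linarith
    then show "(x, y) = (x', y') \<or> y < x' \<or> x < x' \<and> y' < y"
    proof
      assume "v < v'"
      then show ?thesis using xy less by simp
    next
      assume "v = v'"
      then show ?thesis
        using noncrossing_matchingD(2)[OF noncrossing_block_arcs arcs(1), of i' j'] arcs(2)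
          noncrossing_matchingD(1)[OF noncrossing_block_arcs arcs(2)] \<open>x \<le> x'\<close> xy
        by auto
    qed
  qed
next
  case False
  then have page: "strip_page m k = {(5 * v + i, 5 * v + 9 - i) | v i.
      Suc v < m \<and> i < 5 \<and> k = (if even v then 4 else 5)}"
    unfolding strip_page_def block_arcs_def by auto
  show ?thesis
    unfolding page
  proof (rule noncrossing_matchingI)
    fix x y assume "(x, y) \<in> {(5 * v + i, 5 * v + 9 - i) | v i.
      Suc v < m \<and> i < 5 \<and> k = (if even v then 4 else 5)}"
    then show "x < y" by auto
  next
    fix x y x' y'
    assume "(x, y) \<in> {(5 * v + i, 5 * v + 9 - i) | v i.
        Suc v < m \<and> i < 5 \<and> k = (if even v then 4 else 5)}"
      "(x', y') \<in> {(5 * v + i, 5 * v + 9 - i) | v i.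
        Suc v < m \<and> i < 5 \<and> k = (if even v then 4 else 5)}"
    then obtain v i v' i' where xy: "x = 5 * v + i" "y = 5 * v + 9 - i" "x' = 5 * v' + i'" "y' = 5 * v' + 9 - i'"
      and less: "i < 5" "i' < 5"
      and par: "k = (if even v then 4 else 5)" "k = (if even v' then 4 else 5)"
      by blast
    \<comment> \<open>Hence two different quintuples are at least two blocks apart.\<close>
    have "even v = even v'"
      using par by (auto split: if_splits)
    moreover assume "x \<le> x'"
    ultimately have "v = v' \<or> v + 2 \<le> v'"
      using xy less by presburger
    then show "(x, y) = (x', y') \<or> y < x' \<or> x < x' \<and> y' < y"
      using \<open>x \<le> x'\<close> less unfolding xy by auto
  qed
qed

lemma strip_page_block:
  assumes "u < 5" "v < m"
  shows "\<exists>k\<in>{1..5}. lies_on strip_place (strip_page m k) {(u, v), ((u + 1) mod 5, v)}"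
proof -
  \<comment> \<open>the page that \<open>block_arcs\<close> gives to the edge from row \<open>u\<close> to the next row\<close>
  define k :: nat where "k = [1, 2, 1, 3, 2] ! u"
  let ?i = "block_place v u" and ?j = "block_place v ((u + 1) mod 5)"
  have k: "k \<in> {1..5}"
    using assms(1) unfolding less_5_cases k_def by auto
  have "(?i, ?j) \<in> block_arcs k v \<or> (?j, ?i) \<in> block_arcs k v"
    using assms(1) unfolding less_5_cases k_def block_place_def block_arcs_def by auto
  then have "lies_on strip_place (strip_page m k) {(u, v), ((u + 1) mod 5, v)}"
    using assms(2) unfolding strip_page_def strip_place_def by (intro lies_onI) auto
  with k show ?thesis ..
qed

lemma strip_page_step:
  assumes "u < 5" "Suc v < m"
  shows "\<exists>k\<in>{1..5}. lies_on strip_place (strip_page m k) {(u, v), (u, Suc v)}"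
proof -
  define k :: nat where "k = (if even v then 4 else 5)"
  have "strip_place (u, Suc v) = 5 * v + 9 - block_place v u"
    using assms(1) unfolding less_5_cases strip_place_def block_place_def by auto
  then have "(strip_place (u, v), strip_place (u, Suc v)) \<in> strip_page m k"
    using assms block_place_less[OF assms(1), of v]
    unfolding strip_page_def k_def strip_place_def by auto
  then have "lies_on strip_place (strip_page m k) {(u, v), (u, Suc v)}"
    by (intro lies_onI) simp
  moreover have "k \<in> {1..5}"
    unfolding k_def by simp
  ultimately show ?thesis ..
qed

text \<open>
  The closing arcs have their ends outside these intervals. The last three hold because page 4
  leaves the last block free if its index is even, and page 5 leaves the first block free and, if the
  index of the last block is odd, also the last one.
\<close>

lemma strip_page_range:
  shows "strip_page m k \<subseteq> {0..<5 * m} \<times> {0..<5 * m}"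
    and "even w \<Longrightarrow> strip_page (Suc w) 4 \<subseteq> {0..<5 * w} \<times> {0..<5 * w}"
    and "strip_page m 5 \<subseteq> {5..<5 * m} \<times> {5..<5 * m}"
    and "odd w \<Longrightarrow> strip_page (Suc w) 5 \<subseteq> {5..<5 * w} \<times> {5..<5 * w}"
proof -
  show "strip_page m k \<subseteq> {0..<5 * m} \<times> {0..<5 * m}"
    unfolding strip_page_def by (fastforce dest: block_arcs_less)
  have step: "Suc v < w" if "v < w" "even v = even w" for v w :: nat
    using that by presburger
  have pos: "0 < v" if "odd v" for v :: nat
    using that by (rule odd_pos)
  have low: "5 \<le> 5 * v + 9 - i" if "i < 5" for v i :: nat
    using that by linarith
  have high: "5 * v + 9 - i < 5 * w" if "v < w" "even v = even w" for v w i :: nat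
    using step[OF that] by linarith
  show "even w \<Longrightarrow> strip_page (Suc w) 4 \<subseteq> {0..<5 * w} \<times> {0..<5 * w}"
    unfolding strip_page_def block_arcs_def by (auto split: if_splits dest: step)
  show "strip_page m 5 \<subseteq> {5..<5 * m} \<times> {5..<5 * m}"
    unfolding strip_page_def block_arcs_def by (auto split: if_splits dest: pos)
  show "odd w \<Longrightarrow> strip_page (Suc w) 5 \<subseteq> {5..<5 * w} \<times> {5..<5 * w}"
    unfolding strip_page_def block_arcs_def by (auto split: if_splits dest: pos intro: low high)
qed

section \<open>Closing the strip\<close>

lemma five_cycle_product_edgeE:
  assumes "e \<in> edges (cycle_graph 5 \<box> cycle_graph n)"
  obtains u v where "u < 5" "v < n" "e = {(u, v), ((u + 1) mod 5, v)}"
  | u v where "u < 5" "v < n" "e = {(u, v), (u, (v + 1) mod n)}"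
proof -
  consider u v v' where "e = {(u, v), (u, v')}" "u < 5" "{v, v'} \<in> edges (cycle_graph n)"
    | u u' v where "e = {(u, v), (u', v)}" "{u, u'} \<in> edges (cycle_graph 5)" "v < n"
    using assms unfolding box_product_def ugraph.simps Un_iff mem_Collect_eq verts_cycle_graph lessThan_iff
    by blast
  then show ?thesis
  proof cases
    case 1
    then obtain i where "i < n" "{v, v'} = {i, (i + 1) mod n}"
      unfolding cycle_graph_def by auto
    then have "e = {(u, i), (u, (i + 1) mod n)}"
      using 1(1) by (auto simp: doubleton_eq_iff)
    then show ?thesis
      using that(2) 1(2) \<open>i < n\<close> by blast
  next
    case 2
    then obtain i where "i < 5" "{u, u'} = {i, (i + 1) mod 5}"
      unfolding cycle_graph_def by auto
    then have "e = {(i, v), ((i + 1) mod 5, v)}"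
      using 2(1) by (auto simp: doubleton_eq_iff)
    then show ?thesis
      using that(1) 2(3) \<open>i < 5\<close> by blast
  qed
qed

lemma lies_on_mono:
  assumes "lies_on p A e" "A \<subseteq> B" "\<And>x. x \<in> e \<Longrightarrow> p x = q x"
  shows "lies_on q B e"
  using assms unfolding lies_on_def by (metis insertCI subsetD)

text \<open>
  The last column has odd index \<open>w\<close>, so it is reversed and its edges to column 0 join symmetric
  places of the whole strip.
\<close>

lemma five_pages_even:
  assumes w: "odd w" "w \<ge> 3"
  shows "\<exists>\<omega> c. layout (cycle_graph 5 \<box> cycle_graph (Suc w)) \<omega> \<and>
    c ` edges (cycle_graph 5 \<box> cycle_graph (Suc w)) \<subseteq> {1..5} \<and>
    proper_pages (cycle_graph 5 \<box> cycle_graph (Suc w)) \<omega> c"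
proof (rule proper_pages_of_arcs)
  let ?G = "cycle_graph 5 \<box> cycle_graph (Suc w)"
  define R where "R k = (if k = 5 then {(i, 5 * w + 4 - i) | i. i < 5} else {})" for k :: nat
  let ?page = "\<lambda>k. strip_page (Suc w) k \<union> R k"
  show "simple_graph ?G"
    using w by (intro simple_graph_box_product simple_graph_cycle_graph) simp_all
  show "inj_on strip_place (verts ?G)"
    using inj_on_strip_place by (rule inj_on_subset) auto
  show "noncrossing_matching (?page k)" if "k \<in> {1..5}" for k
  proof (cases "k = 5")
    case True
    have "noncrossing_matching (R 5)"
      using w unfolding R_def by (intro noncrossing_matchingI) auto
    moreover have "R 5 \<subseteq> (- {5..<5 * w}) \<times> (- {5..<5 * w})"
      using w unfolding R_def by auto
    ultimately show ?thesis
      using noncrossing_matching_Un[OF noncrossing_strip_page _ strip_page_range(4)[OF w(1)]] True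
      by blast
  next
    case False
    then show ?thesis
      using noncrossing_strip_page unfolding R_def by simp
  qed
  show "\<exists>k\<in>{1..5}. lies_on strip_place (?page k) e" if "e \<in> edges ?G" for e
    using that
  proof (cases rule: five_cycle_product_edgeE)
    case (1 u v)
    then show ?thesis
      using strip_page_block[of u v "Suc w"] lies_on_mono by blast
  next
    case (2 u v)
    show ?thesis
    proof (cases "v = w")
      case True
      have "lies_on strip_place (R 5) {(u, w), (u, 0)}"
      proof (rule lies_onI)
        have "strip_place (u, w) = 5 * w + 4 - strip_place (u, 0)" "strip_place (u, 0) < 5"
          using 2(1) w(1) unfolding less_5_cases strip_place_def block_place_def by auto
        then show "(strip_place (u, w), strip_place (u, 0)) \<in> R 5 \<or>
            (strip_place (u, 0), strip_place (u, w)) \<in> R 5"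
          unfolding R_def by auto
      qed
      then have "lies_on strip_place (?page 5) {(u, w), (u, 0)}"
        by (rule lies_on_mono) auto
      then show ?thesis
        using 2 True by (intro bexI[of _ 5]) simp_all
    next
      case False
      then have "e = {(u, v), (u, Suc v)}" "Suc v < Suc w"
        using 2 by simp_all
      then show ?thesis
        using strip_page_step[OF 2(1), of v "Suc w"] lies_on_mono by blast
    qed
  qed
qed

text \<open>
  For odd \<open>n = w + 3\<close>, the columns \<open>0, ..., w\<close> form a strip and the columns \<open>w + 1\<close> and \<open>w + 2\<close> share
  the ten places after it. Both run through the rows in the order 4, 2, 3, 1, 0, the reverse of
  the order in columns 0 and \<open>w\<close>. This makes their edges to these columns nested.
\<close>

definition tail_place :: "nat \<Rightarrow> nat \<times> nat \<Rightarrow> nat" where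
  "tail_place w = (\<lambda>(u, v).
    if v \<le> w then strip_place (u, v)
    else 5 * w + (if v = Suc w then [14, 11, 9, 10, 5] ! u else [13, 12, 7, 8, 6] ! u))"

text \<open>
  The arcs with an end in the last two columns, with \<open>b\<close> the first place of block \<open>w\<close>. The first
  five arcs of page 4 join block \<open>w\<close> to column \<open>w + 1\<close>, the first five of page 5 join block 0 to
  column \<open>w + 2\<close>. These ten continue the alternation of the strip. The interleaving of the
  two columns and the pages of the other fifteen arcs come from a finite search; one of the fifteen
  goes to page 4 and one to page 5. Position 0 of the list is a dummy, as pages are numbered from 1.
\<close>

definition tail_page :: "nat \<Rightarrow> nat \<Rightarrow> (nat \<times> nat) set" where
  "tail_page w k = (let b = 5 * w in
    [{},
     {(b + 5, b + 10), (b + 7, b + 9), (b + 11, b + 12), (b + 13, b + 14)},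
     {(b + 5, b + 6), (b + 7, b + 8), (b + 9, b + 10), (b + 11, b + 14), (b + 12, b + 13)},
     {(b + 5, b + 14), (b + 6, b + 13), (b + 7, b + 12), (b + 8, b + 10)},
     {(b, b + 14), (b + 1, b + 11), (b + 2, b + 10), (b + 3, b + 9), (b + 4, b + 5), (b + 6, b + 8)},
     {(0, b + 13), (1, b + 12), (2, b + 8), (3, b + 7), (4, b + 6), (b + 9, b + 11)}] ! k)"

lemma page_cases:
  assumes "k \<in> {1..5 :: nat}"
  obtains "k = 1" | "k = 2" | "k = 3" | "k = 4" | "k = 5"
  using assms by fastforce

lemma noncrossing_tail_page: "k \<in> {1..5} \<Longrightarrow> noncrossing_matching (tail_page w k)"
  by (elim page_cases; hypsubst; simp add: tail_page_def Let_def noncrossing_matching_def)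

lemma tail_page_outside:
  shows "k \<in> {1, 2, 3} \<Longrightarrow> tail_page w k \<subseteq> (- {0..<5 * Suc w}) \<times> (- {0..<5 * Suc w})"
    and "tail_page w 4 \<subseteq> (- {0..<5 * w}) \<times> (- {0..<5 * w})"
    and "tail_page w 5 \<subseteq> (- {5..<5 * Suc w}) \<times> (- {5..<5 * Suc w})"
  by (auto simp: tail_page_def Let_def)

lemma noncrossing_strip_tail:
  assumes "even w" and k: "k \<in> {1..5}"
  shows "noncrossing_matching (strip_page (Suc w) k \<union> tail_page w k)"
proof -
  consider "k \<in> {1, 2, 3}" | "k = 4" | "k = 5"
    using k by (elim page_cases) auto
  then show ?thesis
  proof cases
    case 1
    show ?thesis
      using noncrossing_matching_Un[OF noncrossing_strip_page noncrossing_tail_page[OF k]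
          strip_page_range(1) tail_page_outside(1)[OF 1]] .
  next
    case 2
    show ?thesis
      unfolding 2
      using noncrossing_matching_Un[OF noncrossing_strip_page noncrossing_tail_page
          strip_page_range(2)[OF assms(1)] tail_page_outside(2)] by simp
  next
    case 3
    show ?thesis
      unfolding 3
      using noncrossing_matching_Un[OF noncrossing_strip_page noncrossing_tail_page
          strip_page_range(3) tail_page_outside(3)] by simp
  qed
qed

lemma inj_on_tail_place: "inj_on (tail_place w) ({..<5} \<times> {..<w + 3})"
proof -
  have split: "{..<5} \<times> {..<w + 3} = {..<5} \<times> {..w} \<union> {..<5} \<times> {Suc w, Suc (Suc w)}"
    by auto
  have strip: "tail_place w a = strip_place a" if "a \<in> {..<5} \<times> {..w}" for a
    using that unfolding tail_place_def by auto
  have "inj_on strip_place ({..<5} \<times> {..w})"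
    using inj_on_strip_place by (rule inj_on_subset) auto
  then have "inj_on (tail_place w) ({..<5} \<times> {..w})"
    using strip by (simp cong: inj_on_cong)
  moreover have "inj_on (tail_place w) ({..<5} \<times> {Suc w, Suc (Suc w)})"
    unfolding tail_place_def inj_on_def by (auto simp: less_5_cases)
  moreover have "tail_place w a \<noteq> tail_place w b"
    if "a \<in> {..<5} \<times> {..w}" "b \<in> {..<5} \<times> {Suc w, Suc (Suc w)}" for a b
  proof -
    have "tail_place w a < 5 * w + 5"
    proof (cases a)
      case (Pair u v)
      then have "u < 5" "v \<le> w"
        using that(1) by auto
      then show ?thesis
        using strip[OF that(1)] block_place_less[of u v] Pair unfolding strip_place_def by simp
    qed
    moreover have "5 * w + 5 \<le> tail_place w b"
      using that(2) unfolding tail_place_def by (auto simp: less_5_cases)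
    ultimately show ?thesis by linarith
  qed
  ultimately show ?thesis
    unfolding split inj_on_Un by blast
qed

lemma tail_place_simps:
  "tail_place w (u, Suc w) = 5 * w + [14, 11, 9, 10, 5] ! u"
  "tail_place w (u, Suc (Suc w)) = 5 * w + [13, 12, 7, 8, 6] ! u"
  "even w \<Longrightarrow> tail_place w (u, w) = 5 * w + [0, 1, 3, 2, 4] ! u"
  "tail_place w (u, 0) = [0, 1, 3, 2, 4] ! u"
  by (simp_all add: tail_place_def strip_place_def block_place_def)

lemma tail_page_block:
  assumes u: "u < 5" and v: "v = Suc w \<or> v = Suc (Suc w)"
  shows "\<exists>k\<in>{1..5}. lies_on (tail_place w) (tail_page w k) {(u, v), ((u + 1) mod 5, v)}"
proof -
  \<comment> \<open>the page that \<open>tail_page\<close> gives to the edge from row \<open>u\<close> to the next row\<close>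
  define k :: nat where "k = (if v = Suc w then [2, 5, 2, 1, 3] ! u else [2, 3, 2, 4, 3] ! u)"
  have "lies_on (tail_place w) (tail_page w k) {(u, v), ((u + 1) mod 5, v)}"
    using u v unfolding less_5_cases
    by (intro lies_onI, elim disjE)
      (simp_all add: k_def tail_place_simps, simp_all add: tail_page_def Let_def)
  moreover have "k \<in> {1..5}"
    using u unfolding less_5_cases k_def by auto
  ultimately show ?thesis ..
qed

lemma tail_page_step:
  assumes w: "even w" and u: "u < 5" and v: "w \<le> v" "v < w + 3"
  shows "\<exists>k\<in>{1..5}. lies_on (tail_place w) (tail_page w k) {(u, v), (u, (v + 1) mod (w + 3))}"
proof -
  from v consider "v = w" | "v = Suc w" | "v + 1 = w + 3"
    by linarith
  then show ?thesis
  proof cases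
    case 1
    then have next_column: "(v + 1) mod (w + 3) = Suc w"
      by simp
    have "lies_on (tail_place w) (tail_page w 4) {(u, w), (u, Suc w)}"
      using w u unfolding less_5_cases
      by (intro lies_onI, elim disjE)
        (simp_all add: tail_place_simps, simp_all add: tail_page_def Let_def)
    then show ?thesis
      unfolding next_column unfolding 1 by (intro bexI[of _ 4]) simp_all
  next
    case 2
    then have next_column: "(v + 1) mod (w + 3) = Suc (Suc w)"
      by simp
    have "lies_on (tail_place w) (tail_page w ([1, 1, 1, 3, 2] ! u)) {(u, Suc w), (u, Suc (Suc w))}"
      using u unfolding less_5_cases
      by (intro lies_onI, elim disjE)
        (simp_all add: tail_place_simps, simp_all add: tail_page_def Let_def)
    moreover have "[1, 1, 1, 3, 2] ! u \<in> {1..5 :: nat}"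
      using u unfolding less_5_cases by auto
    ultimately show ?thesis
      unfolding next_column unfolding 2 ..
  next
    case 3
    then have next_column: "(v + 1) mod (w + 3) = 0"
      by (simp only: mod_self)
    have v: "v = Suc (Suc w)"
      using 3 by simp
    have "lies_on (tail_place w) (tail_page w 5) {(u, Suc (Suc w)), (u, 0)}"
      using u unfolding less_5_cases
      by (intro lies_onI, elim disjE)
        (simp_all add: tail_place_simps, simp_all add: tail_page_def Let_def)
    then show ?thesis
      unfolding next_column unfolding v by (intro bexI[of _ 5]) simp_all
  qed
qed

lemma five_pages_odd:
  assumes w: "even w"
  shows "\<exists>\<omega> c. layout (cycle_graph 5 \<box> cycle_graph (w + 3)) \<omega> \<and>
    c ` edges (cycle_graph 5 \<box> cycle_graph (w + 3)) \<subseteq> {1..5} \<and>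
    proper_pages (cycle_graph 5 \<box> cycle_graph (w + 3)) \<omega> c"
proof (rule proper_pages_of_arcs)
  let ?G = "cycle_graph 5 \<box> cycle_graph (w + 3)"
  let ?page = "\<lambda>k. strip_page (Suc w) k \<union> tail_page w k"
  show "simple_graph ?G"
    by (intro simple_graph_box_product simple_graph_cycle_graph) simp_all
  show "inj_on (tail_place w) (verts ?G)"
    using inj_on_tail_place by simp
  show "noncrossing_matching (?page k)" if "k \<in> {1..5}" for k
    using noncrossing_strip_tail[OF w that] .
  have strip: "\<exists>k\<in>{1..5}. lies_on (tail_place w) (?page k) e"
    if "\<exists>k\<in>{1..5}. lies_on strip_place (strip_page (Suc w) k) e" "e \<subseteq> UNIV \<times> {..w}" for e
  proof -
    have "strip_place x = tail_place w x" if "x \<in> e" for x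
      using that \<open>e \<subseteq> UNIV \<times> {..w}\<close> unfolding tail_place_def by auto
    then show ?thesis
      using that(1) lies_on_mono by (metis Un_upper1)
  qed
  have tail: "\<exists>k\<in>{1..5}. lies_on (tail_place w) (?page k) e"
    if "\<exists>k\<in>{1..5}. lies_on (tail_place w) (tail_page w k) e" for e
    using that lies_on_mono by (metis Un_upper2)
  show "\<exists>k\<in>{1..5}. lies_on (tail_place w) (?page k) e" if "e \<in> edges ?G" for e
    using that
  proof (cases rule: five_cycle_product_edgeE)
    case (1 u v)
    show ?thesis
    proof (cases "v \<le> w")
      case True
      then show ?thesis
        using strip strip_page_block[OF 1(1), of v "Suc w"] 1(3) by simp
    next
      case False
      then have "v = Suc w \<or> v = Suc (Suc w)"
        using 1(2) by linarith
      then show ?thesis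
        using tail tail_page_block[OF 1(1)] 1(3) by simp
    qed
  next
    case (2 u v)
    show ?thesis
    proof (cases "v < w")
      case True
      then have "e = {(u, v), (u, Suc v)}"
        using 2(3) by simp
      then show ?thesis
        using strip strip_page_step[OF 2(1), of v "Suc w"] True by simp
    next
      case False
      then show ?thesis
        using tail tail_page_step[OF w 2(1) _ 2(2)] 2(3) by simp
    qed
  qed
qed

lemma five_pages:
  assumes "n \<ge> 3"
  shows "\<exists>\<omega> c. layout (cycle_graph 5 \<box> cycle_graph n) \<omega> \<and>
    c ` edges (cycle_graph 5 \<box> cycle_graph n) \<subseteq> {1..5} \<and>
    proper_pages (cycle_graph 5 \<box> cycle_graph n) \<omega> c"
proof (cases "even n")
  case True
  then have "n = Suc (n - 1)" "odd (n - 1)" "n - 1 \<ge> 3"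
    using assms by presburger+
  then show ?thesis
    using five_pages_even by metis
next
  case False
  then have "n = (n - 3) + 3" "even (n - 3)"
    using assms by presburger+
  then show ?thesis
    using five_pages_odd by metis
qed

section \<open>The matching book thickness\<close>

theorem corollary3p3:
  fixes n :: nat
  assumes "n \<ge> 3"
  shows "nearly_dispersable (cycle_graph 5 \<box> cycle_graph n)"
proof -
  let ?G = "cycle_graph 5 \<box> cycle_graph n"
  have C: "simple_graph (cycle_graph 5)" "simple_graph (cycle_graph n)"
    using assms by (auto intro: simple_graph_cycle_graph)
  have G: "simple_graph ?G"
    using simple_graph_box_product[OF C] .
  have deg: "degree ?G x = 4" if x: "x \<in> verts ?G" for x
  proof (cases x)
    case (Pair u v)
    then have "u < 5" "v < n"
      using x by auto
    then show ?thesis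
      using assms Pair by (simp add: degree_box_product[OF C] degree_cycle_graph)
  qed
  have "(0, 0) \<in> verts ?G"
    using assms by simp
  then have "degree ?G ` verts ?G = {4}"
    using deg by force
  then have max: "max_degree ?G = 4"
    unfolding max_degree_def by simp
  \<comment> \<open>The bound is for arbitrary sets of pages, so it also shows that all five pages of the
    embedding below are used.\<close>
  have lower: "5 \<le> card (c ` edges ?G)" if l: "layout ?G \<omega>" and c: "proper_pages ?G \<omega> c" for \<omega> c
  proof (rule ccontr)
    assume "\<not> 5 \<le> card (c ` edges ?G)"
    then have "card (c ` edges ?G) \<le> degree ?G x" if "x \<in> verts ?G" for x
      using deg[OF that] by simp
    from bipartite_if_pages_le_degree[OF G l c this] show False
      using five_cycle_product_not_bipartite[of 0 "cycle_graph n"] assms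
      by simp
  qed
  obtain \<omega> c where l: "layout ?G \<omega>" and c5: "c ` edges ?G \<subseteq> {1..5}" and c: "proper_pages ?G \<omega> c"
    using five_pages[OF assms] by blast
  have "c ` edges ?G = {1..5}"
    using c5 lower[OF l c] by (intro card_seteq) auto
  then have "matching_book_embedding 5 ?G \<omega> c"
    using G l c unfolding matching_book_embedding_def proper_pages_def by blast
  moreover have "5 \<le> k" if "matching_book_embedding k ?G \<omega>' c'" for k \<omega>' c'
  proof -
    have "c' ` edges ?G = {1..k}" "layout ?G \<omega>'" "proper_pages ?G \<omega>' c'"
      using that unfolding matching_book_embedding_def proper_pages_def by blast+
    then show ?thesis
      using lower[of \<omega>' c'] by simp
  qed
  ultimately have "mbt ?G = 5"
    unfolding mbt_def by (intro Least_equality) blast+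
  then show ?thesis
    using max unfolding nearly_dispersable_def by simp
qed

end
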